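(* Let $t\in\mathbb N$, $t\ge 1$, let $(P,d)$ be a finite metric space with $P=B\cupdot R$ (disjoint sets of blue points $B$ and red points $R$) and $|B|\ge t|R|$, and let $k\ge 1$. Then the algorithm $\mathsf{ALG}$ described in the context (compute $1:t$-fairlets by maximum flow with threshold factor $\tau=2$, choose centers by farthest-first traversal on the anchors, assign each fairlet to the center nearest to its anchor) computes a center-aware $4$-approximation for $1:t$-fair $k$-center with $|B|-t|R|$ blue outliers. That is, it outputs a set of centers $C$ and an assignment $\alpha$ forming a $1:t$-fair $k$-clustering with exactly $|B|-t|R|$ outliers, all of them blue, such that $\alpha(c)=c$ for every $c\in C$, and whose cost is at most $4$ times the minimum cost of a $1:t$-fair $k$-clustering with $|B|-t|R|$ outliers.
   Context: **Problem.** A $1:t$-fair $k$-clustering with $z$ outliers is a set $C\subseteq P$ of at most $k$ centers and a map $\alpha:P\to C\cup\{\perp\}$ such that the outlier set $Z=\alpha^{-1}(\perp)$ satisfies $|Z|\le z$ and every nonempty cluster $C_c=\alpha^{-1}(c)$, $c\in C$, is $1:t$-fair, i.e. $|C_c\cap B|=t\,|C_c\cap R|$. Its cost is $\max_{x\in P\setminus Z}d(x,\alpha(x))$. (A center need not be assigned to itself.) A solution is center-aware if $\alpha(c)=c$ for all $c\in C$; an algorithm is a center-aware $4$-approximation if it always outputs a center-aware feasible solution of cost at most $4$ times the optimal cost, where the optimum is over all (not necessarily center-aware) solutions. **Algorithm $\mathsf{ALG}$.** 1. (Fairlets.) Let $D=\{d(x,y): x,y\in P\}$, sorted increasingly. For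 $\delta\in D$ in this order, with $\tau=2$, build the flow network $N_\delta$ with vertices $B\cup R\cup\{v,w\}$, source $v$, sink $w$, edges $(v,b)$ of capacity $1$ for $b\in B$, edges $(b,r)$ of capacity $1$ for $b\in B$, $r\in R$ with $d(b,r)\le\tau\delta$, and edges $(r,w)$ of capacity $t$ for $r\in R$. Compute a maximum integral flow $\mathbf f$. At the first $\delta$ for which $|\mathbf f|=t|R|$, output $\mathcal F=\{f_r: r\in R\}$ with $f_r=\{r\}\cup\{b\in B: \mathbf f(b,r)=1\}$ and anchors $\mathrm{anc}(f_r)=r$, and stop. 2. (Centers.) Let $A=\{\mathrm{anc}(f):f\in\mathcal F\}$. Pick $c_1\in A$ arbitrarily, and for $i=2,\dots,k$ let $c_i\in\arg\max_{c\in A}\min_{j<i}d(c,c_j)$. Let $C=\{c_1,\dots,c_k\}$. 3. (Assignment.) For each $f\in\mathcal F$ let $c_f\in\arg\min_{c\in C}d(c,\mathrm{anc}(f))$ and set $\alpha(p)=c_f$ for all $p\in f$. All points of $P\setminus\bigcup_{f\in\mathcal F}f$ are outliers ($\alpha=\perp$). *)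

theory Defs
  imports "HOL-Analysis.Analysis"
begin

section \<open>Fair clusterings with outliers\<close>

text \<open>An assignment is a map \<open>\<alpha> :: 'a \<Rightarrow> 'a option\<close>, where \<open>None\<close> plays the role of the outlier
  symbol. Only its values on the point set \<open>P\<close> matter. Throughout, \<open>B\<close> are the blue and \<open>R\<close> the
  red points.\<close>

definition outliers :: "'a set \<Rightarrow> ('a \<Rightarrow> 'a option) \<Rightarrow> 'a set" where
  "outliers P \<alpha> = {x \<in> P. \<alpha> x = None}"

definition cluster :: "'a set \<Rightarrow> ('a \<Rightarrow> 'a option) \<Rightarrow> 'a \<Rightarrow> 'a set" where
  "cluster P \<alpha> c = {x \<in> P. \<alpha> x = Some c}"

definition fair :: "'a set \<Rightarrow> 'a set \<Rightarrow> nat \<Rightarrow> 'a set \<Rightarrow> bool" where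
  "fair B R t X \<longleftrightarrow> card (X \<inter> B) = t * card (X \<inter> R)"

definition fair_clustering ::
  "'a set \<Rightarrow> 'a set \<Rightarrow> 'a set \<Rightarrow> nat \<Rightarrow> nat \<Rightarrow> nat \<Rightarrow> 'a set \<Rightarrow> ('a \<Rightarrow> 'a option) \<Rightarrow> bool" where
  "fair_clustering P B R t k z C \<alpha> \<longleftrightarrow>
     C \<subseteq> P \<and> card C \<le> k \<and> \<alpha> ` P \<subseteq> insert None (Some ` C) \<and>
     card (outliers P \<alpha>) \<le> z \<and>
     (\<forall>c\<in>C. cluster P \<alpha> c \<noteq> {} \<longrightarrow> fair B R t (cluster P \<alpha> c))"

text \<open>The maximum over the empty set (every point is an outlier) is taken to be \<open>0\<close>.\<close>

definition cost :: "'a set \<Rightarrow> ('a \<Rightarrow> 'a \<Rightarrow> real) \<Rightarrow> ('a \<Rightarrow> 'a option) \<Rightarrow> real" where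
  "cost P d \<alpha> =
     (if P - outliers P \<alpha> = {} then 0
      else Max ((\<lambda>x. d x (the (\<alpha> x))) ` (P - outliers P \<alpha>)))"

text \<open>For finite \<open>P\<close> this minimum is over a finite set, since every cost is \<open>0\<close> or a distance
  between two points of \<open>P\<close>.\<close>

definition opt_cost ::
  "'a set \<Rightarrow> ('a \<Rightarrow> 'a \<Rightarrow> real) \<Rightarrow> 'a set \<Rightarrow> 'a set \<Rightarrow> nat \<Rightarrow> nat \<Rightarrow> nat \<Rightarrow> real" where
  "opt_cost P d B R t k z = Min {cost P d \<alpha> |C \<alpha>. fair_clustering P B R t k z C \<alpha>}"

definition center_aware :: "'a set \<Rightarrow> ('a \<Rightarrow> 'a option) \<Rightarrow> bool" where
  "center_aware C \<alpha> \<longleftrightarrow> (\<forall>c\<in>C. \<alpha> c = Some c)"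


section \<open>Integral flows\<close>

record 'v flow_net =
  verts :: "'v set"
  arcs :: "('v \<times> 'v) set"
  cap :: "'v \<times> 'v \<Rightarrow> int"
  src :: 'v
  snk :: 'v

definition outflow :: "'v flow_net \<Rightarrow> ('v \<times> 'v \<Rightarrow> int) \<Rightarrow> 'v \<Rightarrow> int" where
  "outflow N f u = (\<Sum>e \<in> {e \<in> arcs N. fst e = u}. f e)"

definition inflow :: "'v flow_net \<Rightarrow> ('v \<times> 'v \<Rightarrow> int) \<Rightarrow> 'v \<Rightarrow> int" where
  "inflow N f u = (\<Sum>e \<in> {e \<in> arcs N. snd e = u}. f e)"

text \<open>Flows are total functions that vanish off the arcs, so that \<open>f (u, v) \<noteq> 0\<close> implies that
  \<open>(u, v)\<close> is an arc.\<close>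

definition integral_flow :: "'v flow_net \<Rightarrow> ('v \<times> 'v \<Rightarrow> int) \<Rightarrow> bool" where
  "integral_flow N f \<longleftrightarrow>
     (\<forall>e \<in> arcs N. 0 \<le> f e \<and> f e \<le> cap N e) \<and>
     (\<forall>e. e \<notin> arcs N \<longrightarrow> f e = 0) \<and>
     (\<forall>u \<in> verts N - {src N, snk N}. inflow N f u = outflow N f u)"

definition flow_value :: "'v flow_net \<Rightarrow> ('v \<times> 'v \<Rightarrow> int) \<Rightarrow> int" where
  "flow_value N f = outflow N f (src N) - inflow N f (src N)"

definition max_integral_flow :: "'v flow_net \<Rightarrow> ('v \<times> 'v \<Rightarrow> int) \<Rightarrow> bool" where
  "max_integral_flow N f \<longleftrightarrow>
     integral_flow N f \<and> (\<forall>g. integral_flow N g \<longrightarrow> flow_value N g \<le> flow_value N f)"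


section \<open>The algorithm\<close>

text \<open>The algorithm makes arbitrary choices (the maximum flow, the first center, ties), so each
  step is a relation between its input and its possible outputs.\<close>

datatype 'a vertex = Source | Point 'a | Sink

fun fairlet_cap :: "nat \<Rightarrow> 'a vertex \<times> 'a vertex \<Rightarrow> int" where
  "fairlet_cap t (Source, Point b) = 1"
| "fairlet_cap t (Point b, Point r) = 1"
| "fairlet_cap t (Point r, Sink) = int t"
| "fairlet_cap t _ = 0"

definition fairlet_net ::
  "('a \<Rightarrow> 'a \<Rightarrow> real) \<Rightarrow> 'a set \<Rightarrow> 'a set \<Rightarrow> nat \<Rightarrow> real \<Rightarrow> real \<Rightarrow> 'a vertex flow_net" where
  "fairlet_net d B R t \<tau> \<delta> =
     \<lparr>verts = Point ` (B \<union> R) \<union> {Source, Sink},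
      arcs = {(Source, Point b) |b. b \<in> B} \<union>
             {(Point b, Point r) |b r. b \<in> B \<and> r \<in> R \<and> d b r \<le> \<tau> * \<delta>} \<union>
             {(Point r, Sink) |r. r \<in> R},
      cap = fairlet_cap t, src = Source, snk = Sink\<rparr>"

definition distances :: "'a set \<Rightarrow> ('a \<Rightarrow> 'a \<Rightarrow> real) \<Rightarrow> real set" where
  "distances P d = {d x y |x y. x \<in> P \<and> y \<in> P}"

definition fairlet :: "'a set \<Rightarrow> ('a vertex \<times> 'a vertex \<Rightarrow> int) \<Rightarrow> 'a \<Rightarrow> 'a set" where
  "fairlet B f r = {r} \<union> {b \<in> B. f (Point b, Point r) = 1}"

text \<open>\<open>F\<close> is the family of fairlets and \<open>anc\<close> the anchor function. The value \<open>\<delta>\<close> is the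
  first distance whose network has a maximum flow of value \<open>t * card R\<close>.\<close>

definition fairlet_step ::
  "'a set \<Rightarrow> ('a \<Rightarrow> 'a \<Rightarrow> real) \<Rightarrow> 'a set \<Rightarrow> 'a set \<Rightarrow> nat \<Rightarrow> real
     \<Rightarrow> 'a set set \<Rightarrow> ('a set \<Rightarrow> 'a) \<Rightarrow> bool" where
  "fairlet_step P d B R t \<tau> F anc \<longleftrightarrow>
     (\<exists>\<delta> \<in> distances P d. \<exists>f.
        (\<forall>\<delta>' \<in> distances P d. \<delta>' < \<delta> \<longrightarrow>
           (\<forall>g. max_integral_flow (fairlet_net d B R t \<tau> \<delta>') g \<longrightarrow>
                flow_value (fairlet_net d B R t \<tau> \<delta>') g \<noteq> int (t * card R))) \<and>
        max_integral_flow (fairlet_net d B R t \<tau> \<delta>) f \<and>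
        flow_value (fairlet_net d B R t \<tau> \<delta>) f = int (t * card R) \<and>
        F = fairlet B f ` R \<and> (\<forall>r\<in>R. anc (fairlet B f r) = r))"

text \<open>Farthest-first traversal. If there are no anchors (that is, \<open>R = {}\<close>), no center can be
  picked, and the step returns the empty set.\<close>

definition center_step :: "('a \<Rightarrow> 'a \<Rightarrow> real) \<Rightarrow> 'a set \<Rightarrow> nat \<Rightarrow> 'a set \<Rightarrow> bool" where
  "center_step d A k C \<longleftrightarrow>
     (if A = {} then C = {}
      else \<exists>c :: nat \<Rightarrow> 'a.
        c 1 \<in> A \<and>
        (\<forall>i\<in>{2..k}. is_arg_max (\<lambda>x. MIN j\<in>{1..<i}. d x (c j)) (\<lambda>x. x \<in> A) (c i)) \<and>
        C = c ` {1..k})"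

definition assignment_step ::
  "'a set \<Rightarrow> ('a \<Rightarrow> 'a \<Rightarrow> real) \<Rightarrow> 'a set set \<Rightarrow> ('a set \<Rightarrow> 'a) \<Rightarrow> 'a set
     \<Rightarrow> ('a \<Rightarrow> 'a option) \<Rightarrow> bool" where
  "assignment_step P d F anc C \<alpha> \<longleftrightarrow>
     (\<forall>f\<in>F. \<exists>c. is_arg_min (\<lambda>c. d c (anc f)) (\<lambda>c. c \<in> C) c \<and> (\<forall>p\<in>f. \<alpha> p = Some c)) \<and>
     (\<forall>p \<in> P - \<Union>F. \<alpha> p = None)"

definition alg_output ::
  "'a set \<Rightarrow> ('a \<Rightarrow> 'a \<Rightarrow> real) \<Rightarrow> 'a set \<Rightarrow> 'a set \<Rightarrow> nat \<Rightarrow> nat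
     \<Rightarrow> 'a set \<Rightarrow> ('a \<Rightarrow> 'a option) \<Rightarrow> bool" where
  "alg_output P d B R t k C \<alpha> \<longleftrightarrow>
     (\<exists>F anc. fairlet_step P d B R t 2 F anc \<and>
        center_step d (anc ` F) k C \<and>
        assignment_step P d F anc C \<alpha>)"

end

theory Submission
  imports Defs
begin

text \<open>A fair clustering with at most \<open>card B - t * card R\<close> outliers has no red outliers.
  Splitting each of its clusters, of radius \<open>\<rho>\<close> around its center, into groups of one red and
  \<open>t\<close> blue points yields fairlets whose blue points are within \<open>2 * \<rho>\<close> of their anchor, hence a
  flow of value \<open>t * card R\<close> at the threshold \<open>\<rho>\<close>. As every cost is a distance, the algorithm
  therefore stops at some \<open>\<delta> \<le> \<rho>\<close>. The anchors, being all the red points, are covered by \<open>k\<close>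
  balls of radius \<open>\<rho>\<close>, so the farthest-first centers cover them within \<open>2 * \<rho>\<close>, and the triangle
  inequality through the anchor gives \<open>2 * \<rho> + 2 * \<rho>\<close>. Centers are anchors at distance \<open>0\<close> from
  themselves, which makes the assignment center-aware.\<close>

section \<open>Disjoint blocks of equal size\<close>

text \<open>Blocks can be cut off one at a time: removing \<open>t\<close> elements for one index
  leaves enough for the others. This shares out the blue points of a cluster among its red
  points.\<close>

lemma disjoint_subsets_of_card:
  fixes t :: nat
  assumes "finite Y" "finite X" "t * card Y \<le> card X"
  shows "\<exists>S. (\<forall>y\<in>Y. S y \<subseteq> X \<and> card (S y) = t) \<and> disjoint_family_on S Y"
  using assms
proof (induction Y arbitrary: X rule: finite_induct)
  case empty
  then show ?case by (auto simp: disjoint_family_on_def)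
next
  case (insert y Y)
  then have "t \<le> card X" by simp
  then obtain T where T: "T \<subseteq> X" "card T = t" by (meson obtain_subset_with_card_n)
  then have "card (X - T) = card X - t"
    using insert.prems by (metis card_Diff_subset finite_subset)
  then have "t * card Y \<le> card (X - T)" using insert by simp
  then obtain S where S: "\<forall>y\<in>Y. S y \<subseteq> X - T \<and> card (S y) = t" "disjoint_family_on S Y"
    using insert by (meson finite_Diff)
  define S' where "S' = S(y := T)"
  have "S' z \<subseteq> X \<and> card (S' z) = t" if "z \<in> insert y Y" for z
    using that S T by (auto simp: S'_def)
  moreover have "disjoint_family_on S' (insert y Y)"
    using S insert.hyps unfolding disjoint_family_on_def S'_def by auto
  ultimately show ?case by blast
qed

section \<open>Farthest-first traversal\<close>

text \<open>The rule for index \<open>i\<close> looks only at smaller indices, so a sequence extends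
  step by step by a maximizer over the finite set \<open>A\<close>. Centers may repeat, so
  \<open>k\<close> may exceed \<open>card A\<close>.\<close>

lemma farthest_first_traversal_exists:
  assumes "finite A" "A \<noteq> {}"
  shows "\<exists>C. center_step d A k C"
proof -
  have "\<exists>c :: nat \<Rightarrow> 'a. c 1 \<in> A \<and>
    (\<forall>i\<in>{2..k}. is_arg_max (\<lambda>x. MIN j\<in>{1..<i}. d x (c j)) (\<lambda>x. x \<in> A) (c i))"
  proof (induction k)
    case 0
    from assms obtain a where "a \<in> A" by blast
    then show ?case by (intro exI[of _ "\<lambda>_. a"]) auto
  next
    case (Suc k)
    then obtain c :: "nat \<Rightarrow> 'a" where c: "c 1 \<in> A"
      "\<And>i. i \<in> {2..k} \<Longrightarrow> is_arg_max (\<lambda>x. MIN j\<in>{1..<i}. d x (c j)) (\<lambda>x. x \<in> A) (c i)"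
      by blast
    show ?case
    proof (cases "Suc k \<ge> 2")
      case False
      then show ?thesis using c(1) by auto
    next
      case True
      let ?g = "\<lambda>x. MIN j\<in>{1..<Suc k}. d x (c j)"
      have "\<exists>a. is_arg_min (\<lambda>x. - ?g x) (\<lambda>x. x \<in> A) a"
        using ex_is_arg_min_if_finite[OF assms] by blast
      then obtain a where a: "is_arg_max ?g (\<lambda>x. x \<in> A) a"
        by (auto simp: is_arg_min_def is_arg_max_def)
      let ?c = "c(Suc k := a)"
      have "is_arg_max (\<lambda>x. MIN j\<in>{1..<i}. d x (?c j)) (\<lambda>x. x \<in> A) (?c i)"
        if "i \<in> {2..Suc k}" for i
      proof -
        \<comment> \<open>Overwriting index \<open>Suc k\<close> leaves all objectives up to
          \<open>i = Suc k\<close> unchanged, as they only involve indices below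
          \<open>i\<close>.\<close>
        have "(\<lambda>j. d x (?c j)) ` {1..<i} = (\<lambda>j. d x (c j)) ` {1..<i}" for x
          using that by (intro image_cong) auto
        then show ?thesis using a c(2)[of i] that by (cases "i = Suc k") auto
      qed
      moreover have "?c 1 \<in> A" using c(1) True by simp
      ultimately show ?thesis by blast
    qed
  qed
  then show ?thesis using assms unfolding center_step_def by auto
qed

lemma center_step_subset:
  assumes "center_step d A k C"
  shows "C \<subseteq> A"
proof (cases "A = {}")
  case False
  with assms obtain c :: "nat \<Rightarrow> 'a" where c: "c 1 \<in> A"
      "\<forall>i\<in>{2..k}. is_arg_max (\<lambda>x. MIN j\<in>{1..<i}. d x (c j)) (\<lambda>x. x \<in> A) (c i)"
      "C = c ` {1..k}"
    by (auto simp: center_step_def)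
  have "c i \<in> A" if "i \<in> {1..k}" for i
    using c that by (cases "i = 1") (auto simp: is_arg_max_def)
  with c show ?thesis by auto
qed (use assms in \<open>simp add: center_step_def\<close>)

lemma center_step_card:
  assumes "center_step d A k C"
  shows "card C \<le> k" "finite C"
proof -
  have "C = {} \<or> (\<exists>c. C = c ` {1..k})"
    using assms by (auto simp: center_step_def split: if_splits)
  then show "card C \<le> k" "finite C"
    using card_image_le[of "{1..k}"] by auto
qed

lemma center_step_nonempty:
  assumes "center_step d A k C" "A \<noteq> {}" "k \<ge> 1"
  shows "C \<noteq> {}"
  using assms by (auto simp: center_step_def)

text \<open>A point farther than \<open>2 * \<rho>\<close> from all centers would, by the greedy choice, force the
  \<open>k\<close> centers and that point to have pairwise distances above \<open>2 * \<rho>\<close>, so that no two of these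
  \<open>k + 1\<close> points fit into the same ball of radius \<open>\<rho>\<close>.\<close>

lemma (in Metric_space) farthest_first_traversal_radius:
  assumes A: "A \<subseteq> M" and Q: "Q \<subseteq> M" "finite Q" "card Q \<le> k"
    and cover: "\<And>x. x \<in> A \<Longrightarrow> \<exists>q\<in>Q. d x q \<le> \<rho>"
    and C: "center_step d A k C" and a: "a \<in> A"
  shows "\<exists>c\<in>C. d a c \<le> 2 * \<rho>"
proof (rule ccontr)
  assume "\<not> ?thesis"
  then have far: "\<And>c. c \<in> C \<Longrightarrow> d a c > 2 * \<rho>" by force
  have "A \<noteq> {}" using a by blast
  with C obtain c :: "nat \<Rightarrow> 'a" where c: "c 1 \<in> A"
      "\<And>i. i \<in> {2..k} \<Longrightarrow> is_arg_max (\<lambda>x. MIN j\<in>{1..<i}. d x (c j)) (\<lambda>x. x \<in> A) (c i)"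
      "C = c ` {1..k}"
    unfolding center_step_def by (simp only: if_False) blast
  have sep: "d (c i) (c j) > 2 * \<rho>" if "1 \<le> j" "j < i" "i \<le> k" for i j
  proof -
    \<comment> \<open>The uncovered point \<open>a\<close> was a candidate for every choice
      \<open>c i\<close>, so the chosen point is at least as far from the earlier centers as
      \<open>a\<close> is.\<close>
    have "(MIN j\<in>{1..<i}. d a (c j)) > 2 * \<rho>"
      using that far c(3) by (subst Min_gr_iff) auto
    moreover have "is_arg_max (\<lambda>x. MIN j\<in>{1..<i}. d x (c j)) (\<lambda>x. x \<in> A) (c i)"
      using that by (intro c(2)) auto
    then have "\<not> (MIN j\<in>{1..<i}. d (c i) (c j)) < (MIN j\<in>{1..<i}. d a (c j))"
      using a unfolding is_arg_max_def by blast
    moreover have "(MIN j\<in>{1..<i}. d (c i) (c j)) \<le> d (c i) (c j)"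
      using that by (intro Min_le) auto
    ultimately show ?thesis by linarith
  qed
  \<comment> \<open>Centers are indexed from 1, so the free index 0 can hold \<open>a\<close>;
    \<open>p\<close> then lists \<open>k + 1\<close> points on \<open>{..k}\<close>.\<close>
  define p where "p = c(0 := a)"
  have psep: "d (p i) (p j) > 2 * \<rho>" if "i < j" "j \<le> k" for i j
    using that sep[of i j] far[of "c j"] c(3) commute by (auto simp: p_def)
  have pA: "p i \<in> A" if "i \<le> k" for i
    using center_step_subset[OF C] c(3) that a by (auto simp: p_def)
  have "\<forall>i\<in>{..k}. \<exists>q\<in>Q. d (p i) q \<le> \<rho>" using cover[OF pA] by simp
  then obtain q where "\<forall>i\<in>{..k}. q i \<in> Q \<and> d (p i) (q i) \<le> \<rho>"
    by (auto simp: bchoice_iff Bex_def)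
  then have q: "q i \<in> Q" "d (p i) (q i) \<le> \<rho>" if "i \<le> k" for i using that by auto
  have "q ` {..k} \<subseteq> Q" using q by auto
  \<comment> \<open>Pigeonhole: \<open>k + 1\<close> indices are mapped to at most \<open>k\<close>
    ball centers.\<close>
  then have "card (q ` {..k}) < card {..k}"
    using Q card_mono[of Q "q ` {..k}"] by simp
  then have "\<not> inj_on q {..k}" using pigeonhole by blast
  then obtain i j where ij: "i < j" "j \<le> k" "q i = q j"
    unfolding inj_on_def by (metis atMost_iff linorder_neqE_nat)
  have "d (p i) (p j) \<le> d (p i) (q i) + d (q i) (p j)"
    using q(1)[of i] pA[of i] pA[of j] ij A Q by (intro triangle) auto
  also have "\<dots> \<le> 2 * \<rho>"
    using q(2)[of i] q(2)[of j] ij commute[of "q i" "p j"] by simp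
  finally show False using psep[OF ij(1,2)] by simp
qed

section \<open>Costs as distances\<close>

lemma dist_le_cost:
  assumes "finite P" "x \<in> P" "\<alpha> x = Some c"
  shows "d x c \<le> cost P d \<alpha>"
proof -
  have "x \<in> P - outliers P \<alpha>" using assms by (auto simp: outliers_def)
  then show ?thesis using assms unfolding cost_def
    by (auto intro!: Max_ge image_eqI[of _ _ x])
qed

locale two_colored_metric = Metric_space P d
  for P :: "'a set" and d :: "'a \<Rightarrow> 'a \<Rightarrow> real" +
  fixes B R :: "'a set"
  assumes finite_P: "finite P" and P_eq: "P = B \<union> R" and disjoint_BR: "B \<inter> R = {}"
begin

lemma finite_B: "finite B" and finite_R: "finite R"
  using finite_P P_eq by auto

text \<open>A family of fairlets is encoded by the blue part \<open>S r\<close> of the fairlet with anchor \<open>r\<close>.\<close>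

definition blue_parts :: "nat \<Rightarrow> ('a \<Rightarrow> 'a set) \<Rightarrow> bool" where
  "blue_parts t S \<longleftrightarrow> (\<forall>r\<in>R. S r \<subseteq> B \<and> card (S r) = t) \<and> disjoint_family_on S R"

lemma finite_distances: "finite (distances P d)"
proof -
  have "distances P d = (\<lambda>(x, y). d x y) ` (P \<times> P)"
    by (auto simp: distances_def)
  then show ?thesis using finite_P by simp
qed

text \<open>The algorithm tries only distances as thresholds, so this makes the cost of any
  comparison clustering one of the candidates. If all points are outliers, the cost \<open>0\<close>
  is the distance from a point to itself, which needs \<open>P\<close> nonempty.\<close>

lemma cost_in_distances:
  assumes "\<alpha> ` P \<subseteq> insert None (Some ` C)" "C \<subseteq> P" "P \<noteq> {}"
  shows "cost P d \<alpha> \<in> distances P d"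
proof (cases "P - outliers P \<alpha> = {}")
  case True
  from assms obtain x where "x \<in> P" by blast
  then show ?thesis using True by (force simp: cost_def distances_def)
next
  case False
  then have "cost P d \<alpha> \<in> (\<lambda>x. d x (the (\<alpha> x))) ` (P - outliers P \<alpha>)"
    using finite_P by (auto simp: cost_def simp del: Diff_eq_empty_iff intro!: Max_in)
  then obtain x where "x \<in> P - outliers P \<alpha>" and x: "cost P d \<alpha> = d x (the (\<alpha> x))"
    by blast
  then have "x \<in> P" "\<alpha> x \<noteq> None" by (auto simp: outliers_def)

  moreover from this have "the (\<alpha> x) \<in> P" using assms by force
  ultimately show ?thesis using x by (auto simp: distances_def)
qed

section \<open>Flows in the fairlet network\<close>

text \<open>Assuming only that \<open>f\<close> vanishes off the arcs serves two purposes: reading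
  off a given flow and checking conservation for a constructed one. Pairs beyond the threshold
  contribute zero, so the sums may run over all of \<open>R\<close> or \<open>B\<close>.\<close>

lemma fairlet_net_balance:
  assumes off: "\<And>e. e \<notin> arcs (fairlet_net d B R t \<tau> \<delta>) \<Longrightarrow> f e = 0"
  shows inflow_blue:
      "b \<in> B \<Longrightarrow> inflow (fairlet_net d B R t \<tau> \<delta>) f (Point b) = f (Source, Point b)"
    and outflow_blue: "b \<in> B \<Longrightarrow>
      outflow (fairlet_net d B R t \<tau> \<delta>) f (Point b) = (\<Sum>r\<in>R. f (Point b, Point r))"
    and inflow_red: "r \<in> R \<Longrightarrow>
      inflow (fairlet_net d B R t \<tau> \<delta>) f (Point r) = (\<Sum>b\<in>B. f (Point b, Point r))"
    and outflow_red:
      "r \<in> R \<Longrightarrow> outflow (fairlet_net d B R t \<tau> \<delta>) f (Point r) = f (Point r, Sink)"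
proof -
  let ?N = "fairlet_net d B R t \<tau> \<delta>"
  show "inflow ?N f (Point b) = f (Source, Point b)" if b: "b \<in> B"
  proof -
    have "inflow ?N f (Point b) = sum f {(Source, Point b)}"
      unfolding inflow_def using b disjoint_BR by (intro sum.cong) (auto simp: fairlet_net_def)
    then show ?thesis by simp
  qed
  show "outflow ?N f (Point b) = (\<Sum>r\<in>R. f (Point b, Point r))" if b: "b \<in> B"
  proof -
    have "outflow ?N f (Point b) = sum f ((\<lambda>r. (Point b, Point r)) ` R)"
      unfolding outflow_def using b disjoint_BR finite_R off
      by (intro sum.mono_neutral_left) (auto simp: fairlet_net_def)
    also have "\<dots> = (\<Sum>r\<in>R. f (Point b, Point r))"
      by (subst sum.reindex) (auto simp: inj_on_def)
    finally show ?thesis .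
  qed
  show "inflow ?N f (Point r) = (\<Sum>b\<in>B. f (Point b, Point r))" if r: "r \<in> R"
  proof -
    have "inflow ?N f (Point r) = sum f ((\<lambda>b. (Point b, Point r)) ` B)"
      unfolding inflow_def using r disjoint_BR finite_B off
      by (intro sum.mono_neutral_left) (auto simp: fairlet_net_def)
    also have "\<dots> = (\<Sum>b\<in>B. f (Point b, Point r))"
      by (subst sum.reindex) (auto simp: inj_on_def)
    finally show ?thesis .
  qed
  show "outflow ?N f (Point r) = f (Point r, Sink)" if r: "r \<in> R"
  proof -
    have "outflow ?N f (Point r) = sum f {(Point r, Sink)}"
      unfolding outflow_def using r disjoint_BR by (intro sum.cong) (auto simp: fairlet_net_def)
    then show ?thesis by simp
  qed
qed

lemma fairlet_net_flow:
  assumes "integral_flow (fairlet_net d B R t \<tau> \<delta>) f"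
  shows source_flow: "b \<in> B \<Longrightarrow> f (Source, Point b) = (\<Sum>r\<in>R. f (Point b, Point r))"
    and sink_flow: "r \<in> R \<Longrightarrow> f (Point r, Sink) = (\<Sum>b\<in>B. f (Point b, Point r))"
    and fairlet_flow_value:
      "flow_value (fairlet_net d B R t \<tau> \<delta>) f = (\<Sum>b\<in>B. f (Source, Point b))"
proof -
  let ?N = "fairlet_net d B R t \<tau> \<delta>"
  have off: "f e = 0" if "e \<notin> arcs ?N" for e
    using assms that unfolding integral_flow_def by blast
  have cons: "inflow ?N f u = outflow ?N f u" if "u \<in> Point ` (B \<union> R)" for u
    using assms that by (auto simp: integral_flow_def fairlet_net_def)
  show "f (Source, Point b) = (\<Sum>r\<in>R. f (Point b, Point r))" if "b \<in> B"
    using cons[of "Point b"] that inflow_blue[OF off that] outflow_blue[OF off that] by simp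
  show "f (Point r, Sink) = (\<Sum>b\<in>B. f (Point b, Point r))" if "r \<in> R"
    using cons[of "Point r"] that inflow_red[OF off that] outflow_red[OF off that] by simp
  have "inflow ?N f Source = sum f {}"
    unfolding inflow_def by (intro sum.cong) (auto simp: fairlet_net_def)
  moreover have "outflow ?N f Source = sum f ((\<lambda>b. (Source, Point b)) ` B)"
    unfolding outflow_def by (intro sum.cong) (auto simp: fairlet_net_def)
  moreover have "\<dots> = (\<Sum>b\<in>B. f (Source, Point b))"
    by (subst sum.reindex) (auto simp: inj_on_def)
  ultimately show "flow_value ?N f = (\<Sum>b\<in>B. f (Source, Point b))"
    by (simp add: flow_value_def) (simp add: fairlet_net_def)
qed

text \<open>Double counting of the middle arcs turns the value at the source into the value at the
  sink.\<close>

lemma fairlet_flow_value_sink: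
  assumes "integral_flow (fairlet_net d B R t \<tau> \<delta>) f"
  shows "flow_value (fairlet_net d B R t \<tau> \<delta>) f = (\<Sum>r\<in>R. f (Point r, Sink))"
proof -
  have "flow_value (fairlet_net d B R t \<tau> \<delta>) f = (\<Sum>b\<in>B. \<Sum>r\<in>R. f (Point b, Point r))"
    using fairlet_flow_value[OF assms] source_flow[OF assms] by simp
  also have "\<dots> = (\<Sum>r\<in>R. \<Sum>b\<in>B. f (Point b, Point r))" by (rule sum.swap)
  finally show ?thesis using sink_flow[OF assms] by simp
qed

text \<open>Integrality and capacity 1 leave only 0 and 1 on the middle arcs. The value 1 occurs
  only on an arc, so selected pairs respect the threshold.\<close>

lemma fairlet_flow_capacity:
  assumes "integral_flow (fairlet_net d B R t \<tau> \<delta>) f"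
  shows "b \<in> B \<Longrightarrow> f (Source, Point b) \<le> 1"
    and "r \<in> R \<Longrightarrow> f (Point r, Sink) \<le> int t"
    and "f (Point b, Point r) \<in> {0, 1}"
    and "f (Point b, Point r) = 1 \<Longrightarrow> d b r \<le> \<tau> * \<delta>"
proof -
  let ?N = "fairlet_net d B R t \<tau> \<delta>"
  have on: "0 \<le> f e" "f e \<le> fairlet_cap t e" if "e \<in> arcs ?N" for e
    using assms that by (auto simp: integral_flow_def fairlet_net_def)
  have off: "f e = 0" if "e \<notin> arcs ?N" for e
    using assms that unfolding integral_flow_def by blast
  show "f (Source, Point b) \<le> 1" if "b \<in> B"
    using on(2)[of "(Source, Point b)"] that by (simp add: fairlet_net_def)
  show "f (Point r, Sink) \<le> int t" if "r \<in> R"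
    using on(2)[of "(Point r, Sink)"] that by (simp add: fairlet_net_def)
  show "f (Point b, Point r) \<in> {0, 1}"
    using on[of "(Point b, Point r)"] off[of "(Point b, Point r)"]
    by (cases "(Point b, Point r) \<in> arcs ?N") auto
  show "d b r \<le> \<tau> * \<delta>" if "f (Point b, Point r) = 1"
    using off[of "(Point b, Point r)"] that by (force simp: fairlet_net_def)
qed

text \<open>The sink arcs form a cut of capacity \<open>t * card R\<close>, so any flow attaining
  this value is maximum.\<close>

lemma fairlet_flow_value_le:
  assumes "integral_flow (fairlet_net d B R t \<tau> \<delta>) f"
  shows "flow_value (fairlet_net d B R t \<tau> \<delta>) f \<le> int (t * card R)"
proof -
  have "(\<Sum>r\<in>R. f (Point r, Sink)) \<le> (\<Sum>r\<in>R. int t)"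
    using fairlet_flow_capacity[OF assms] by (intro sum_mono)
  then show ?thesis using fairlet_flow_value_sink[OF assms] by (simp add: mult.commute)
qed

text \<open>One unit is sent from the source through each \<open>b\<close> in \<open>S r\<close> to
  \<open>r\<close>, and \<open>t\<close> units from \<open>r\<close> to the sink. Disjointness of
  the blue parts keeps the load of every blue point at most 1.\<close>

lemma fairlet_flow_of_blue_parts:
  assumes S: "blue_parts t S" and close: "\<And>r b. r \<in> R \<Longrightarrow> b \<in> S r \<Longrightarrow> d b r \<le> \<tau> * \<delta>"
  shows "\<exists>f. max_integral_flow (fairlet_net d B R t \<tau> \<delta>) f \<and>
    flow_value (fairlet_net d B R t \<tau> \<delta>) f = int (t * card R)"
proof -
  let ?N = "fairlet_net d B R t \<tau> \<delta>"
  define f :: "'a vertex \<times> 'a vertex \<Rightarrow> int" where "f = (\<lambda>e. case e of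
      (Source, Point b) \<Rightarrow> if \<exists>r\<in>R. b \<in> S r then 1 else 0
    | (Point b, Point r) \<Rightarrow> if r \<in> R \<and> b \<in> S r then 1 else 0
    | (Point r, Sink) \<Rightarrow> if r \<in> R then int t else 0
    | _ \<Rightarrow> 0)"
  have f_simps: "f (Source, Point b) = (if \<exists>r\<in>R. b \<in> S r then 1 else 0)"
      "f (Point b, Point r) = (if r \<in> R \<and> b \<in> S r then 1 else 0)"
      "f (Point r, Sink) = (if r \<in> R then int t else 0)" for b r
    by (auto simp: f_def)
  have SB: "S r \<subseteq> B" "card (S r) = t" if "r \<in> R" for r
    using S that by (auto simp: blue_parts_def)
  have uniq: "r = r'" if "r \<in> R" "r' \<in> R" "b \<in> S r" "b \<in> S r'" for r r' b
    using S that unfolding blue_parts_def disjoint_family_on_def by blast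
  have off: "f e = 0" if "e \<notin> arcs ?N" for e
    using that SB(1)[THEN subsetD] close
    by (auto simp: f_def fairlet_net_def split: prod.splits vertex.splits)
  have on: "0 \<le> f e \<and> f e \<le> cap ?N e" if "e \<in> arcs ?N" for e
    using that by (auto simp: f_simps fairlet_net_def)
  have out_blue: "outflow ?N f (Point b) = inflow ?N f (Point b)" if b: "b \<in> B" for b
  proof -
    have "(\<Sum>r\<in>R. f (Point b, Point r)) = f (Source, Point b)"
    proof (cases "\<exists>r\<in>R. b \<in> S r")
      case True
      then obtain r where r: "r \<in> R" "b \<in> S r" by blast
      \<comment> \<open>By disjointness only the anchor owning \<open>b\<close> contributes.\<close>
      then have "(\<Sum>r\<in>R. f (Point b, Point r)) = (\<Sum>r'\<in>R. if r' = r then 1 else 0)"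
        using uniq by (intro sum.cong) (auto simp: f_simps)
      then show ?thesis using r finite_R by (auto simp: f_simps)
    qed (auto simp: f_simps)
    then show ?thesis using inflow_blue[OF off b] outflow_blue[OF off b] by simp
  qed
  have out_red: "outflow ?N f (Point r) = inflow ?N f (Point r)" if r: "r \<in> R" for r
  proof -
    have "(\<Sum>b\<in>B. f (Point b, Point r)) = (\<Sum>b\<in>S r. f (Point b, Point r))"
      using finite_B SB[OF r] by (intro sum.mono_neutral_right) (auto simp: f_simps)
    also have "\<dots> = int t" using r SB[OF r] by (simp add: f_simps)
    finally show ?thesis
      using inflow_red[OF off r] outflow_red[OF off r] r by (simp add: f_simps)
  qed
  have flow: "integral_flow ?N f"
    unfolding integral_flow_def using on off out_blue out_red
    by (auto simp: fairlet_net_def)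
  have "flow_value ?N f = int (t * card R)"
    using fairlet_flow_value_sink[OF flow] by (simp add: f_simps mult.commute)
  then show ?thesis
    using flow fairlet_flow_value_le unfolding max_integral_flow_def by metis
qed

text \<open>Converse of the construction above: full value saturates every sink arc, so each red
  point receives exactly \<open>t\<close> units, while source capacities prevent a blue point from
  serving two anchors.\<close>

lemma blue_parts_of_fairlet_flow:
  assumes f: "integral_flow (fairlet_net d B R t \<tau> \<delta>) f"
    and val: "flow_value (fairlet_net d B R t \<tau> \<delta>) f = int (t * card R)"
  shows "blue_parts t (\<lambda>r. {b \<in> B. f (Point b, Point r) = 1})"
proof -
  have bin: "f (Point b, Point r) \<in> {0, 1}" for b r
    using fairlet_flow_capacity(3)[OF f] .
  \<comment> \<open>The total slack of the sink arcs is zero and each slack is nonnegative.\<close>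
  have "(\<Sum>r\<in>R. int t - f (Point r, Sink)) = 0"
    using val fairlet_flow_value_sink[OF f] by (simp add: sum_subtractf mult.commute)
  then have sat: "f (Point r, Sink) = int t" if "r \<in> R" for r
    using that fairlet_flow_capacity(2)[OF f] finite_R
    by (subst (asm) sum_nonneg_eq_0_iff) auto
  have "card {b \<in> B. f (Point b, Point r) = 1} = t" if r: "r \<in> R" for r
  proof -
    have "int t = (\<Sum>b\<in>B. f (Point b, Point r))" using sat[OF r] sink_flow[OF f r] by simp
    also have "\<dots> = (\<Sum>b\<in>{b \<in> B. f (Point b, Point r) = 1}. f (Point b, Point r))"
      using bin finite_B by (intro sum.mono_neutral_right) auto
    also have "\<dots> = int (card {b \<in> B. f (Point b, Point r) = 1})" by simp
    finally show ?thesis by simp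
  qed
  moreover have "r = r'" if "r \<in> R" "r' \<in> R" and b: "b \<in> B"
    "f (Point b, Point r) = 1" "f (Point b, Point r') = 1" for r r' b
  proof (rule ccontr)
    assume "r \<noteq> r'"
    then have "2 = (\<Sum>r\<in>{r, r'}. f (Point b, Point r))" using b by simp
    also have "\<dots> \<le> (\<Sum>r\<in>R. f (Point b, Point r))"
      using that finite_R bin by (intro sum_mono2) (auto, metis order_refl zero_le_one bin insertE singletonD)
    also have "\<dots> \<le> 1"
      using source_flow[OF f b(1)] fairlet_flow_capacity(1)[OF f b(1)] by simp
    finally show False by simp
  qed
  ultimately show ?thesis by (auto simp: blue_parts_def disjoint_family_on_def)
qed

section \<open>Fairlets inside a fair clustering\<close>

text \<open>With \<open>m\<close> red outliers, fairness leaves \<open>card B - t * card R + t * m\<close> blue outliers, so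
  the bound on the number of outliers forces \<open>m = 0\<close>.\<close>

lemma no_red_outliers:
  assumes fc: "fair_clustering P B R t k (card B - t * card R) C \<alpha>"
    and le: "t * card R \<le> card B"
  shows "r \<in> R \<Longrightarrow> \<alpha> r \<noteq> None"
proof -
  let ?O = "outliers P \<alpha>"
  have C: "finite C" "C \<subseteq> P" using fc finite_P finite_subset by (auto simp: fair_clustering_def)
  \<comment> \<open>Outliers and clusters partition \<open>P\<close>; the count is needed for both
    \<open>X = B\<close> and \<open>X = R\<close>.\<close>
  have split: "card X = card (?O \<inter> X) + (\<Sum>c\<in>C. card (cluster P \<alpha> c \<inter> X))" if X: "X \<subseteq> P" for X
  proof -
    have fX: "finite X" using X finite_P finite_subset by blast
    have "X = (?O \<inter> X) \<union> (\<Union>c\<in>C. cluster P \<alpha> c \<inter> X)"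
      using X fc by (fastforce simp: fair_clustering_def outliers_def cluster_def)
    moreover have "(?O \<inter> X) \<inter> (\<Union>c\<in>C. cluster P \<alpha> c \<inter> X) = {}"
      by (auto simp: outliers_def cluster_def)
    ultimately have "card X = card (?O \<inter> X) + card (\<Union>c\<in>C. cluster P \<alpha> c \<inter> X)"
      using fX C by (metis card_Un_disjoint finite_Un)
    also have "card (\<Union>c\<in>C. cluster P \<alpha> c \<inter> X) = (\<Sum>c\<in>C. card (cluster P \<alpha> c \<inter> X))"
      using C fX by (intro card_UN_disjoint) (auto simp: cluster_def)
    finally show ?thesis .
  qed
  \<comment> \<open>Fairness is demanded of nonempty clusters; for empty ones both sides are
    0.\<close>
  have "card (cluster P \<alpha> c \<inter> B) = t * card (cluster P \<alpha> c \<inter> R)" if "c \<in> C" for c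
    using fc that by (cases "cluster P \<alpha> c = {}") (auto simp: fair_clustering_def fair_def)
  then have "(\<Sum>c\<in>C. card (cluster P \<alpha> c \<inter> B)) = t * (\<Sum>c\<in>C. card (cluster P \<alpha> c \<inter> R))"
    by (simp add: sum_distrib_left)
  then have B: "card B = card (?O \<inter> B) + t * (\<Sum>c\<in>C. card (cluster P \<alpha> c \<inter> R))"
    using split[of B] P_eq by simp
  have "?O = (?O \<inter> B) \<union> (?O \<inter> R)" using P_eq by (auto simp: outliers_def)
  then have "card ?O = card (?O \<inter> B) + card (?O \<inter> R)"
    using finite_B finite_R disjoint_BR
    by (metis card_Un_disjoint finite_Int inf_bot_right inf_commute inf_left_commute)
  moreover have "card ?O \<le> card B - t * card R"
    using fc by (simp add: fair_clustering_def)
  ultimately have "card (?O \<inter> B) + card (?O \<inter> R) + t * card R \<le> card B"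
    using le by linarith
  \<comment> \<open>Substituting both counts cancels the clustered points and leaves
    \<open>(t + 1) * card (?O \<inter> R) \<le> 0\<close>.\<close>
  then have "card (?O \<inter> R) = 0"
    using B split[of R] P_eq by (simp add: algebra_simps)
  then show "r \<in> R \<Longrightarrow> \<alpha> r \<noteq> None"
    using finite_R P_eq by (auto simp: outliers_def)
qed

text \<open>Every red point lies in a cluster, and fairness provides \<open>t\<close> blue points
  there for each of its red points. The factor 2 comes from the triangle inequality through the
  common center.\<close>

lemma blue_parts_of_fair_clustering:
  assumes fc: "fair_clustering P B R t k (card B - t * card R) C \<alpha>"
    and le: "t * card R \<le> card B"
  shows "\<exists>S. blue_parts t S \<and> (\<forall>r\<in>R. \<forall>b\<in>S r. d b r \<le> 2 * cost P d \<alpha>)"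
proof -
  have C: "C \<subseteq> P" and im: "\<alpha> ` P \<subseteq> insert None (Some ` C)"
    using fc by (auto simp: fair_clustering_def)
  have "\<exists>S. (\<forall>r\<in>cluster P \<alpha> c \<inter> R. S r \<subseteq> cluster P \<alpha> c \<inter> B \<and> card (S r) = t) \<and>
      disjoint_family_on S (cluster P \<alpha> c \<inter> R)" if "c \<in> C" for c
  proof (rule disjoint_subsets_of_card)
    show "t * card (cluster P \<alpha> c \<inter> R) \<le> card (cluster P \<alpha> c \<inter> B)"
      using fc that by (cases "cluster P \<alpha> c = {}") (auto simp: fair_clustering_def fair_def)
  qed (use finite_B finite_R in auto)
  then obtain T where T: "\<And>c r. c \<in> C \<Longrightarrow> r \<in> cluster P \<alpha> c \<inter> R \<Longrightarrow>
        T c r \<subseteq> cluster P \<alpha> c \<inter> B \<and> card (T c r) = t"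
      "\<And>c. c \<in> C \<Longrightarrow> disjoint_family_on (T c) (cluster P \<alpha> c \<inter> R)"
    by metis
  \<comment> \<open>The splittings \<open>T c\<close> of the single clusters are glued:
    \<open>r\<close> uses that of its own cluster.\<close>
  define S where "S r = T (the (\<alpha> r)) r" for r
  have \<alpha>R: "\<exists>c\<in>C. \<alpha> r = Some c" if "r \<in> R" for r
    using no_red_outliers[OF fc le that] im that P_eq by auto
  have S: "\<exists>c\<in>C. \<alpha> r = Some c \<and> S r = T c r \<and> r \<in> cluster P \<alpha> c \<inter> R \<and>
      S r \<subseteq> cluster P \<alpha> c \<inter> B \<and> card (S r) = t" if r: "r \<in> R" for r
  proof -
    obtain c where "c \<in> C" "\<alpha> r = Some c" using \<alpha>R[OF r] by blast
    moreover from this have "r \<in> cluster P \<alpha> c \<inter> R" using r P_eq by (simp add: cluster_def)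
    ultimately show ?thesis using T(1)[of c r] by (auto simp: S_def)
  qed
  have "r = r'" if r: "r \<in> R" "r' \<in> R" and b: "b \<in> S r" "b \<in> S r'" for r r' b
  proof -
    obtain c where c: "c \<in> C" "S r = T c r" "r \<in> cluster P \<alpha> c \<inter> R" "S r \<subseteq> cluster P \<alpha> c \<inter> B"
      using S[OF r(1)] by blast
    obtain c' where c': "c' \<in> C" "S r' = T c' r'" "r' \<in> cluster P \<alpha> c' \<inter> R"
        "S r' \<subseteq> cluster P \<alpha> c' \<inter> B"
      using S[OF r(2)] by blast
    have "b \<in> cluster P \<alpha> c" "b \<in> cluster P \<alpha> c'" using c(4) c'(4) b by blast+
    \<comment> \<open>A shared blue point has only one center, so both anchors lie in one cluster,
      where the blocks are disjoint.\<close>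
    then have "c = c'" by (simp add: cluster_def)
    then show ?thesis using T(2)[OF c(1)] c c' r b unfolding disjoint_family_on_def by blast
  qed
  then have "blue_parts t S"
    using S unfolding blue_parts_def disjoint_family_on_def by blast
  moreover have "d b r \<le> 2 * cost P d \<alpha>" if r: "r \<in> R" and b: "b \<in> S r" for b r
  proof -
    obtain c where c: "c \<in> C" "\<alpha> r = Some c" "S r \<subseteq> cluster P \<alpha> c \<inter> B"
      using S[OF r] by blast
    then have b: "b \<in> P" "\<alpha> b = Some c" and r: "r \<in> P"
      using r b P_eq by (auto simp: cluster_def)
    have "d b r \<le> d b c + d r c"
      using triangle[of b c r] b r c C commute[of c r] by auto
    then show ?thesis
      using dist_le_cost[of P b \<alpha> c d] dist_le_cost[of P r \<alpha> c d] finite_P b r c by simp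
  qed
  ultimately show ?thesis by blast
qed

section \<open>Steps of the algorithm and existence of an output\<close>

text \<open>Translates the first step out of flow language. The last clause holds because a family
  of blue parts within \<open>\<tau> * \<delta>'\<close> gives a maximum flow of full value at
  \<open>\<delta>'\<close>, so the search cannot have passed \<open>\<delta>'\<close>.\<close>

lemma fairlet_step_parts:
  assumes "fairlet_step P d B R t \<tau> F anc"
  shows "\<exists>\<delta> S. blue_parts t S \<and> (\<forall>r\<in>R. \<forall>b\<in>S r. d b r \<le> \<tau> * \<delta>) \<and>
     F = (\<lambda>r. insert r (S r)) ` R \<and> (\<forall>r\<in>R. anc (insert r (S r)) = r) \<and>
     (\<forall>\<delta>' S'. \<delta>' \<in> distances P d \<longrightarrow> blue_parts t S' \<longrightarrow>
        (\<forall>r\<in>R. \<forall>b\<in>S' r. d b r \<le> \<tau> * \<delta>') \<longrightarrow> \<delta> \<le> \<delta>')"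
proof -
  obtain \<delta> f where \<delta>: "\<forall>\<delta>' \<in> distances P d. \<delta>' < \<delta> \<longrightarrow>
           (\<forall>g. max_integral_flow (fairlet_net d B R t \<tau> \<delta>') g \<longrightarrow>
                flow_value (fairlet_net d B R t \<tau> \<delta>') g \<noteq> int (t * card R))"
    and f: "integral_flow (fairlet_net d B R t \<tau> \<delta>) f"
      "flow_value (fairlet_net d B R t \<tau> \<delta>) f = int (t * card R)"
    and F: "F = fairlet B f ` R" "\<forall>r\<in>R. anc (fairlet B f r) = r"
    using assms unfolding fairlet_step_def max_integral_flow_def by blast
  define S where "S = (\<lambda>r. {b \<in> B. f (Point b, Point r) = 1})"
  have fS: "fairlet B f r = insert r (S r)" for r by (auto simp: S_def fairlet_def)
  have "\<delta> \<le> \<delta>'" if "\<delta>' \<in> distances P d" "blue_parts t S'"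
      "\<forall>r\<in>R. \<forall>b\<in>S' r. d b r \<le> \<tau> * \<delta>'" for \<delta>' S'
    using fairlet_flow_of_blue_parts[OF that(2)] that \<delta> by (meson not_le)
  moreover have "blue_parts t S"
    using blue_parts_of_fairlet_flow[OF f] by (simp add: S_def)
  moreover have "d b r \<le> \<tau> * \<delta>" if "b \<in> S r" for b r
    using fairlet_flow_capacity(4)[OF f(1)] that by (simp add: S_def)
  ultimately show ?thesis using F unfolding fS by blast
qed

text \<open>At the largest distance every blue-red pair is an arc, because
  \<open>\<tau> \<ge> 1\<close>; any splitting of the blue points then succeeds. The least
  successful threshold exists since there are finitely many distances.\<close>

lemma fairlet_step_exists:
  assumes le: "t * card R \<le> card B" and ne: "P \<noteq> {}" and \<tau>: "\<tau> \<ge> 1"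
  shows "\<exists>F anc. fairlet_step P d B R t \<tau> F anc"
proof -
  let ?ok = "\<lambda>\<delta> f. max_integral_flow (fairlet_net d B R t \<tau> \<delta>) f \<and>
    flow_value (fairlet_net d B R t \<tau> \<delta>) f = int (t * card R)"
  define G where "G = {\<delta> \<in> distances P d. \<exists>f. ?ok \<delta> f}"
  have Dne: "distances P d \<noteq> {}" using ne by (auto simp: distances_def)
  define \<delta>1 where "\<delta>1 = Max (distances P d)"
  have "d x y \<in> distances P d" if "x \<in> P" "y \<in> P" for x y
    using that by (auto simp: distances_def)
  then have \<delta>1: "\<delta>1 \<in> distances P d" "\<And>x y. x \<in> P \<Longrightarrow> y \<in> P \<Longrightarrow> d x y \<le> \<delta>1"
    using finite_distances Dne by (auto simp: \<delta>1_def)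
  obtain x where x: "x \<in> P" using ne by blast
  then have \<delta>1_nonneg: "0 \<le> \<delta>1" using \<delta>1(2)[OF x x] by simp
  obtain S where S: "blue_parts t S"
    using disjoint_subsets_of_card[OF finite_R finite_B le] by (auto simp: blue_parts_def)
  have "d b r \<le> \<tau> * \<delta>1" if "r \<in> R" "b \<in> S r" for b r
  proof -
    have "d b r \<le> \<delta>1" using \<delta>1(2) S that P_eq by (auto simp: blue_parts_def)
    also have "\<dots> \<le> \<tau> * \<delta>1" using \<tau> \<delta>1_nonneg by (simp add: mult_le_cancel_right1)
    finally show ?thesis .
  qed
  then have "\<delta>1 \<in> G" using fairlet_flow_of_blue_parts[OF S] \<delta>1(1) by (auto simp: G_def)
  moreover have "finite G" using finite_distances by (simp add: G_def)
  ultimately have min: "Min G \<in> G" "\<And>\<delta>. \<delta> \<in> G \<Longrightarrow> Min G \<le> \<delta>"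
    using Min_in by auto
  then obtain f where f: "?ok (Min G) f" by (auto simp: G_def)
  define anc where "anc = inv_into R (fairlet B f)"
  \<comment> \<open>A fairlet contains exactly one red point, which determines its anchor.\<close>
  have "inj_on (fairlet B f) R"
    using disjoint_BR by (auto simp: inj_on_def fairlet_def)
  then have "\<forall>r\<in>R. anc (fairlet B f r) = r" by (simp add: anc_def)
  moreover have "\<not> ?ok \<delta>' g" if "\<delta>' \<in> distances P d" "\<delta>' < Min G" for \<delta>' g
    using that min(2)[of \<delta>'] by (auto simp: G_def)
  ultimately have "fairlet_step P d B R t \<tau> (fairlet B f ` R) anc"
    unfolding fairlet_step_def using f min(1) by (auto simp: G_def intro!: bexI[of _ "Min G"] exI[of _ f])
  then show ?thesis by blast
qed

text \<open>Fairlets are pairwise disjoint, so choosing a nearest center for each one separately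
  causes no conflict.\<close>

lemma assignment_step_exists:
  assumes F: "fairlet_step P d B R t \<tau> F anc" and C: "center_step d (anc ` F) k C" and k: "k \<ge> 1"
  shows "\<exists>\<alpha>. assignment_step P d F anc C \<alpha>"
proof -
  obtain S where S: "blue_parts t S" "F = (\<lambda>r. insert r (S r)) ` R"
    using fairlet_step_parts[OF F] by blast
  have disj: "f = g" if fg: "f \<in> F" "g \<in> F" and p: "p \<in> f" "p \<in> g" for f g p
  proof -
    obtain r r' where r: "r \<in> R" "f = insert r (S r)" "r' \<in> R" "g = insert r' (S r')"
      using fg S(2) by auto
    then have "S r \<subseteq> B" "S r' \<subseteq> B" "r = r' \<or> S r \<inter> S r' = {}"
      using S(1) unfolding blue_parts_def disjoint_family_on_def by blast+
    \<comment> \<open>A red common point is the anchor of both fairlets; a blue one lies in both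
      blue parts.\<close>
    then have "r = r'" using p r disjoint_BR by blast
    then show ?thesis using r by simp
  qed
  have "\<exists>c. is_arg_min (\<lambda>c. d c (anc f)) (\<lambda>c. c \<in> C) c" if "f \<in> F" for f
    using center_step_nonempty[OF C] center_step_card[OF C] that k ex_is_arg_min_if_finite[of C]
    by blast
  then obtain c where c: "\<And>f. f \<in> F \<Longrightarrow> is_arg_min (\<lambda>c. d c (anc f)) (\<lambda>c. c \<in> C) (c f)"
    by metis
  define \<alpha> where "\<alpha> p = (if p \<in> \<Union>F then Some (c (SOME f. f \<in> F \<and> p \<in> f)) else None)" for p
  have "\<alpha> p = Some (c f)" if "f \<in> F" "p \<in> f" for f p
  proof -
    have "(SOME f. f \<in> F \<and> p \<in> f) = f" using that disj by (intro some_equality) auto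
    then show ?thesis using that by (auto simp: \<alpha>_def)
  qed
  then have "assignment_step P d F anc C \<alpha>"
    unfolding assignment_step_def using c by (auto simp: \<alpha>_def)
  then show ?thesis by blast
qed

lemma alg_output_exists:
  assumes "t * card R \<le> card B" "P \<noteq> {}" "k \<ge> 1"
  shows "\<exists>C \<alpha>. alg_output P d B R t k C \<alpha>"
proof -
  obtain F anc where F: "fairlet_step P d B R t 2 F anc"
    using fairlet_step_exists[OF assms(1,2), of 2] by auto
  then have "finite (anc ` F)" using finite_R by (auto simp: fairlet_step_def)
  then obtain C where C: "center_step d (anc ` F) k C"
    \<comment> \<open>Without fairlets there are no anchors, and the step returns the empty
      set.\<close>
    using farthest_first_traversal_exists[of "anc ` F" d k] by (cases "F = {}") (auto simp: center_step_def)
  then show ?thesis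
    using assignment_step_exists[OF F C] F assms(3) unfolding alg_output_def by blast
qed

section \<open>Feasibility and cost of the output\<close>

text \<open>Indexes a whole run by red points, eliminating \<open>F\<close> and \<open>anc\<close>:
  \<open>a r\<close> is the center of the fairlet anchored at \<open>r\<close>.\<close>

lemma alg_output_parts:
  assumes "alg_output P d B R t k C \<alpha>"
  shows "\<exists>S a \<delta>. blue_parts t S \<and> center_step d R k C \<and>
    (\<forall>r\<in>R. a r \<in> C \<and> (\<forall>c\<in>C. d r (a r) \<le> d r c) \<and> (\<forall>p\<in>insert r (S r). \<alpha> p = Some (a r))) \<and>
    outliers P \<alpha> = B - (\<Union>r\<in>R. S r) \<and>
    (\<forall>r\<in>R. \<forall>b\<in>S r. d b r \<le> 2 * \<delta>) \<and>
    (\<forall>\<delta>'\<in>distances P d. \<forall>S'. blue_parts t S' \<and> (\<forall>r\<in>R. \<forall>b\<in>S' r. d b r \<le> 2 * \<delta>')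
       \<longrightarrow> \<delta> \<le> \<delta>')"
proof -
  obtain F anc where F: "fairlet_step P d B R t 2 F anc"
    and C: "center_step d (anc ` F) k C" and \<alpha>: "assignment_step P d F anc C \<alpha>"
    using assms by (auto simp: alg_output_def)
  obtain \<delta> S where S: "blue_parts t S" "\<And>r b. r \<in> R \<Longrightarrow> b \<in> S r \<Longrightarrow> d b r \<le> 2 * \<delta>"
    "F = (\<lambda>r. insert r (S r)) ` R" "\<And>r. r \<in> R \<Longrightarrow> anc (insert r (S r)) = r"
    "\<And>\<delta>' S'. \<delta>' \<in> distances P d \<Longrightarrow> blue_parts t S' \<Longrightarrow>
        \<forall>r\<in>R. \<forall>b\<in>S' r. d b r \<le> 2 * \<delta>' \<Longrightarrow> \<delta> \<le> \<delta>'"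
    using fairlet_step_parts[OF F] by blast
  have "anc ` F = R" unfolding S(3) image_image using S(4) by simp
  with C have C': "center_step d R k C" by simp
  have "\<exists>c. is_arg_min (\<lambda>c. d c r) (\<lambda>c. c \<in> C) c \<and> (\<forall>p\<in>insert r (S r). \<alpha> p = Some c)"
    if r: "r \<in> R" for r
  proof -
    have "insert r (S r) \<in> F" using r S(3) by simp
    then show ?thesis using \<alpha> S(4)[OF r] unfolding assignment_step_def by fastforce
  qed
  then obtain a where a: "\<And>r. r \<in> R \<Longrightarrow> is_arg_min (\<lambda>c. d c r) (\<lambda>c. c \<in> C) (a r)"
    "\<And>r p. r \<in> R \<Longrightarrow> p \<in> insert r (S r) \<Longrightarrow> \<alpha> p = Some (a r)"
    by metis
  have O: "outliers P \<alpha> = B - (\<Union>r\<in>R. S r)"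
  proof
    have "p \<notin> \<Union>F" if "p \<in> outliers P \<alpha>" for p
      using a(2) S(3) that by (auto simp: outliers_def)
    then show "outliers P \<alpha> \<subseteq> B - (\<Union>r\<in>R. S r)"
      using S(3) P_eq by (auto simp: outliers_def)
    show "B - (\<Union>r\<in>R. S r) \<subseteq> outliers P \<alpha>"
      using \<alpha> S(3) P_eq disjoint_BR by (auto simp: outliers_def assignment_step_def)
  qed
  have "d r (a r) \<le> d r c" if "r \<in> R" "c \<in> C" for r c
    using a(1)[OF that(1)] that commute by (force simp: is_arg_min_def not_less)
  moreover have "a r \<in> C" if "r \<in> R" for r
    using a(1)[OF that] by (simp add: is_arg_min_def)
  ultimately have "\<forall>r\<in>R. a r \<in> C \<and> (\<forall>c\<in>C. d r (a r) \<le> d r c) \<and>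
      (\<forall>p\<in>insert r (S r). \<alpha> p = Some (a r))"
    using a(2) by simp
  moreover have "\<forall>r\<in>R. \<forall>b\<in>S r. d b r \<le> 2 * \<delta>" using S(2) by simp
  moreover have "\<forall>\<delta>'\<in>distances P d. \<forall>S'.
      blue_parts t S' \<and> (\<forall>r\<in>R. \<forall>b\<in>S' r. d b r \<le> 2 * \<delta>') \<longrightarrow> \<delta> \<le> \<delta>'"
    using S(5) by (intro ballI allI impI, elim conjE)
  ultimately show ?thesis using S(1) C' O
    by - (rule exI[of _ S], rule exI[of _ a], rule exI[of _ \<delta>], intro conjI)
qed

text \<open>With \<open>Q = R\<close> this counts the outliers; with \<open>Q\<close> the anchors of
  one center it gives fairness of a cluster.\<close>

lemma card_UN_blue_parts:
  assumes "blue_parts t S" "Q \<subseteq> R"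
  shows "card (\<Union>r\<in>Q. S r) = t * card Q"
proof -
  have "card (\<Union>r\<in>Q. S r) = (\<Sum>r\<in>Q. card (S r))"
    using assms finite_R finite_B
    by (intro card_UN_disjoint)
      (auto simp: blue_parts_def disjoint_family_on_def subset_iff intro: finite_subset)
  also have "\<dots> = (\<Sum>r\<in>Q. t)"
    using assms by (intro sum.cong) (auto simp: blue_parts_def)
  finally show ?thesis by (simp add: mult.commute)
qed

text \<open>Each red point belongs to its own fairlet, so only blue points are left over. A cluster
  is a union of whole fairlets, each with one red and \<open>t\<close> blue points.\<close>

lemma alg_output_feasible:
  assumes out: "alg_output P d B R t k C \<alpha>" and le: "t * card R \<le> card B"
  shows "fair_clustering P B R t k (card B - t * card R) C \<alpha>"
    and "card (outliers P \<alpha>) = card B - t * card R"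
    and "outliers P \<alpha> \<subseteq> B"
    and "center_aware C \<alpha>"
proof -
  obtain S a where S: "blue_parts t S" and C: "center_step d R k C"
    and a: "\<forall>r\<in>R. a r \<in> C \<and> (\<forall>c\<in>C. d r (a r) \<le> d r c) \<and> (\<forall>p\<in>insert r (S r). \<alpha> p = Some (a r))"
    and O: "outliers P \<alpha> = B - (\<Union>r\<in>R. S r)"
    using alg_output_parts[OF out] by (elim exE conjE) (rule that; assumption)
  have aC: "\<And>r. r \<in> R \<Longrightarrow> a r \<in> C"
    and a_min: "\<And>r c. r \<in> R \<Longrightarrow> c \<in> C \<Longrightarrow> d r (a r) \<le> d r c"
    and \<alpha>R: "\<And>r. r \<in> R \<Longrightarrow> \<alpha> r = Some (a r)"
    and \<alpha>S: "\<And>r b. r \<in> R \<Longrightarrow> b \<in> S r \<Longrightarrow> \<alpha> b = Some (a r)"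
    using a by simp_all
  have SB: "S r \<subseteq> B" if "r \<in> R" for r using S that by (auto simp: blue_parts_def)
  have CR: "C \<subseteq> R" using center_step_subset[OF C] .
  show "outliers P \<alpha> \<subseteq> B" using O by blast
  have "card (B - (\<Union>r\<in>R. S r)) = card B - card (\<Union>r\<in>R. S r)"
    using SB finite_B by (intro card_Diff_subset) (auto intro: finite_subset[of _ B])
  then show cO: "card (outliers P \<alpha>) = card B - t * card R"
    using O card_UN_blue_parts[OF S, of R] by simp
  \<comment> \<open>A center is itself an anchor at distance 0 from \<open>c\<close>, so its nearest
    center also has distance 0 and no tie with another point is possible.\<close>
  have "a c = c" if "c \<in> C" for c
  proof -
    have "c \<in> R" using that CR by blast
    moreover have "c \<in> P" "a c \<in> P" using CR aC[OF \<open>c \<in> R\<close>] \<open>c \<in> R\<close> P_eq by auto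
    ultimately show ?thesis using a_min[of c c] that nonneg[of c "a c"] by auto
  qed
  then show "center_aware C \<alpha>" using \<alpha>R CR unfolding center_aware_def by (metis subsetD)
  have blue: "\<exists>r\<in>R. b \<in> S r" if "b \<in> B" "\<alpha> b \<noteq> None" for b
  proof -
    have "b \<notin> outliers P \<alpha>" using that by (simp add: outliers_def)
    then show ?thesis using O that(1) by blast
  qed
  have "fair B R t (cluster P \<alpha> c)" for c
  proof -
    let ?Q = "{r \<in> R. a r = c}"
    have "cluster P \<alpha> c \<inter> R = ?Q" using \<alpha>R P_eq by (auto simp: cluster_def)
    moreover have "cluster P \<alpha> c \<inter> B = (\<Union>r\<in>?Q. S r)"
    proof
      show "cluster P \<alpha> c \<inter> B \<subseteq> (\<Union>r\<in>?Q. S r)"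
        using blue \<alpha>S by (fastforce simp: cluster_def)
      show "(\<Union>r\<in>?Q. S r) \<subseteq> cluster P \<alpha> c \<inter> B"
        using \<alpha>S SB P_eq by (auto simp: cluster_def)
    qed
    ultimately show ?thesis using card_UN_blue_parts[OF S, of ?Q] by (simp add: fair_def)
  qed
  moreover have "\<alpha> ` P \<subseteq> insert None (Some ` C)"
  proof -
    have "\<alpha> p \<in> insert None (Some ` C)" if "p \<in> P" for p
    proof (cases "p \<in> R \<or> \<alpha> p = None")
      case True
      then show ?thesis using \<alpha>R[of p] aC[of p] by auto
    next
      case False
      then obtain r where "r \<in> R" "p \<in> S r" using blue[of p] \<open>p \<in> P\<close> P_eq by auto
      then show ?thesis using \<alpha>S[of r p] aC[of r] by simp
    qed
    then show ?thesis by (rule image_subsetI)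
  qed
  ultimately show "fair_clustering P B R t k (card B - t * card R) C \<alpha>"
    unfolding fair_clustering_def using CR P_eq center_step_card[OF C] cO by auto
qed

text \<open>Comparison with an arbitrary fair clustering suffices, since the optimum is attained by
  one of them.\<close>

lemma alg_output_cost:
  assumes out: "alg_output P d B R t k C \<alpha>" and le: "t * card R \<le> card B" and ne: "P \<noteq> {}"
    and fc: "fair_clustering P B R t k (card B - t * card R) C' \<alpha>'"
  shows "cost P d \<alpha> \<le> 4 * cost P d \<alpha>'"
proof -
  obtain S a \<delta> where S: "blue_parts t S" and C: "center_step d R k C"
    and a: "\<forall>r\<in>R. a r \<in> C \<and> (\<forall>c\<in>C. d r (a r) \<le> d r c) \<and> (\<forall>p\<in>insert r (S r). \<alpha> p = Some (a r))"
    and O: "outliers P \<alpha> = B - (\<Union>r\<in>R. S r)"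
    and S_close: "\<forall>r\<in>R. \<forall>b\<in>S r. d b r \<le> 2 * \<delta>"
    and first: "\<forall>\<delta>'\<in>distances P d. \<forall>S'. blue_parts t S' \<and> (\<forall>r\<in>R. \<forall>b\<in>S' r. d b r \<le> 2 * \<delta>')
       \<longrightarrow> \<delta> \<le> \<delta>'"
    using alg_output_parts[OF out] by (elim exE conjE) (rule that; assumption)
  have aC: "\<And>r. r \<in> R \<Longrightarrow> a r \<in> C"
    and a_min: "\<And>r c. r \<in> R \<Longrightarrow> c \<in> C \<Longrightarrow> d r (a r) \<le> d r c"
    and \<alpha>R: "\<And>r. r \<in> R \<Longrightarrow> \<alpha> r = Some (a r)"
    and \<alpha>S: "\<And>r b. r \<in> R \<Longrightarrow> b \<in> S r \<Longrightarrow> \<alpha> b = Some (a r)"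
    using a by simp_all
  let ?\<rho> = "cost P d \<alpha>'"
  have C': "C' \<subseteq> P" "card C' \<le> k" "\<alpha>' ` P \<subseteq> insert None (Some ` C')"
    using fc by (auto simp: fair_clustering_def)
  have \<rho>D: "?\<rho> \<in> distances P d" using cost_in_distances C' ne by blast
  then have \<rho>_nonneg: "0 \<le> ?\<rho>" by (auto simp: distances_def)
  \<comment> \<open>The cost \<open>?\<rho>\<close> is a candidate threshold, and the fairlets cut
    from the comparison clustering succeed there.\<close>
  have \<delta>: "\<delta> \<le> ?\<rho>"
    using first \<rho>D blue_parts_of_fair_clustering[OF fc le] by blast
  have "\<exists>q\<in>C'. d r q \<le> ?\<rho>" if r: "r \<in> R" for r
  proof -
    have "\<alpha>' r \<noteq> None" using no_red_outliers[OF fc le r] .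
    then obtain q where "q \<in> C'" "\<alpha>' r = Some q" using C'(3) r P_eq by auto
    then show ?thesis using dist_le_cost[OF finite_P] r P_eq by blast
  qed
  then have near: "\<exists>c\<in>C. d r c \<le> 2 * ?\<rho>" if "r \<in> R" for r
    using farthest_first_traversal_radius[of R C' k ?\<rho> C r] C C' P_eq finite_P that
    by (meson finite_subset sup_ge2)
  have red: "d r (a r) \<le> 2 * ?\<rho>" if "r \<in> R" for r
    using near[OF that] a_min[OF that] by force
  have bound: "d x (the (\<alpha> x)) \<le> 4 * ?\<rho>" if x: "x \<in> P - outliers P \<alpha>" for x
  proof (cases "x \<in> R")
    case True
    then show ?thesis using red[OF True] \<alpha>R[OF True] \<rho>_nonneg by simp
  next
    case False
    then obtain r where r: "r \<in> R" "x \<in> S r" using x O P_eq by auto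
    have "a r \<in> P" using aC[OF r(1)] center_step_subset[OF C] P_eq by blast
    \<comment> \<open>The first distance is at most \<open>2 * \<delta>\<close>, hence at most
      \<open>2 * ?\<rho>\<close>; the second is at most \<open>2 * ?\<rho>\<close> by the traversal
      bound.\<close>
    then have "d x (a r) \<le> d x r + d r (a r)"
      using triangle[of x r "a r"] x r P_eq by blast
    then show ?thesis using S_close[rule_format, OF r] \<delta> red[OF r(1)] \<alpha>S[OF r] by simp
  qed
  show ?thesis
    unfolding cost_def[of P d \<alpha>] using bound finite_P \<rho>_nonneg by auto
qed

end

theorem theorem2p2:
  fixes P B R :: "'a set" and d :: "'a \<Rightarrow> 'a \<Rightarrow> real" and t k :: nat
  assumes "Metric_space P d" and "finite P"
    and "P = B \<union> R" and "B \<inter> R = {}"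
    and "t \<ge> 1" and "k \<ge> 1"
    and "card B \<ge> t * card R"
  shows "(P \<noteq> {} \<longrightarrow> (\<exists>C \<alpha>. alg_output P d B R t k C \<alpha>)) \<and>
    (\<forall>C \<alpha>. alg_output P d B R t k C \<alpha> \<longrightarrow>
       fair_clustering P B R t k (card B - t * card R) C \<alpha> \<and>
       card (outliers P \<alpha>) = card B - t * card R \<and>
       outliers P \<alpha> \<subseteq> B \<and>
       center_aware C \<alpha> \<and>
       cost P d \<alpha> \<le> 4 * opt_cost P d B R t k (card B - t * card R))"
proof -
  interpret Metric_space P d by fact
  interpret two_colored_metric P d B R
    using assms by unfold_locales
  let ?z = "card B - t * card R"
  let ?costs = "{cost P d \<alpha> |C \<alpha>. fair_clustering P B R t k ?z C \<alpha>}"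
  have "cost P d \<alpha> \<le> 4 * opt_cost P d B R t k ?z" if out: "alg_output P d B R t k C \<alpha>" for C \<alpha>
  proof -
    \<comment> \<open>Any run stops at some threshold in \<open>distances P d\<close>, which is
      empty for empty \<open>P\<close>.\<close>
    have ne: "P \<noteq> {}"
      using out by (auto simp: alg_output_def fairlet_step_def distances_def)
    have "?costs \<subseteq> distances P d"
      using cost_in_distances ne by (auto simp: fair_clustering_def)
    then have "finite ?costs" using finite_distances finite_subset by blast
    \<comment> \<open>The output itself is a feasible solution, so the minimum defining
      \<open>opt_cost\<close> is attained.\<close>
    moreover have "?costs \<noteq> {}"
      using alg_output_feasible(1)[OF out assms(7)] by blast
    ultimately have "Min ?costs \<in> ?costs" by (rule Min_in)
    then obtain C' \<alpha>' where "fair_clustering P B R t k ?z C' \<alpha>'"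
        "opt_cost P d B R t k ?z = cost P d \<alpha>'"
      unfolding opt_cost_def by blast
    then show ?thesis using alg_output_cost[OF out assms(7) ne] by simp
  qed
  then show ?thesis
    using alg_output_exists alg_output_feasible assms by simp
qed

end
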